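(* Let $a,b,c,d,e$ be nonzero integers, and let $f(x)=\frac{(x+a)(x+b)(x+c)}{x}$ and $g(y)=\frac{(y+d)(y+e)(y+cd/a)}{y^2}$. Then the Diophantine equation $z^2=f(x)^2+g(y)^2$ or the Diophantine equation $z^2=f(x)^2-g(y)^2$ has infinitely many nontrivial rational solutions $(x,y,z)\in\mathbb{Q}^3$.
   Context: A solution $(x,y,z)$ of $z^2=f(x)^2\pm g(y)^2$ is called nontrivial if $f(x)g(y)\neq 0$ and $f(x)^2\neq g(y)^2$. *)

theory Defs
  imports Complex_Main
begin

definition laurent_f :: "int \<Rightarrow> int \<Rightarrow> int \<Rightarrow> rat \<Rightarrow> rat" where
  "laurent_f a b c x = (x + of_int a) * (x + of_int b) * (x + of_int c) / x"

definition laurent_g :: "int \<Rightarrow> int \<Rightarrow> int \<Rightarrow> int \<Rightarrow> rat \<Rightarrow> rat" where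
  "laurent_g a c d e y =
     (y + of_int d) * (y + of_int e) * (y + of_int c * of_int d / of_int a) / y ^ 2"

definition nontrivial :: "(rat \<Rightarrow> rat) \<Rightarrow> (rat \<Rightarrow> rat) \<Rightarrow> rat \<times> rat \<times> rat \<Rightarrow> bool" where
  "nontrivial f g = (\<lambda>(x, y, z). f x * g y \<noteq> 0 \<and> (f x)\<^sup>2 \<noteq> (g y)\<^sup>2)"

text \<open>The Laurent polynomials have their only poles at 0, where HOL division would return 0;
  points with a coordinate \<open>x = 0\<close> or \<open>y = 0\<close> are therefore excluded explicitly.\<close>

definition sum_solutions :: "(rat \<Rightarrow> rat) \<Rightarrow> (rat \<Rightarrow> rat) \<Rightarrow> (rat \<times> rat \<times> rat) set" where
  "sum_solutions f g = {(x, y, z). x \<noteq> 0 \<and> y \<noteq> 0 \<and> z\<^sup>2 = (f x)\<^sup>2 + (g y)\<^sup>2}"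

definition diff_solutions :: "(rat \<Rightarrow> rat) \<Rightarrow> (rat \<Rightarrow> rat) \<Rightarrow> (rat \<times> rat \<times> rat) set" where
  "diff_solutions f g = {(x, y, z). x \<noteq> 0 \<and> y \<noteq> 0 \<and> z\<^sup>2 = (f x)\<^sup>2 - (g y)\<^sup>2}"

end

theory Submission
  imports Defs "HOL-Computational_Algebra.Polynomial"
begin

text \<open>
  Put \<open>k = d / a\<close> and \<open>h w = (w + a) (w + c) / w\<close>. Since \<open>h\<close> is invariant under \<open>w \<mapsto> a c / w\<close>,
  the values \<open>f (a c / w) = h w (a c + b w) / w\<close> and \<open>g (k w) = h w (e + k w) / w\<close> share a factor,
  and the difference equation becomes the conic \<open>Z\<^sup>2 = (a c + b w)\<^sup>2 - (e + k w)\<^sup>2\<close>. It is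
  parametrised by Pythagorean triples unless the two linear forms are proportional, that is, \<open>c d = b e\<close>.

  In that case \<open>g (c d / v) = L f v\<close> with \<open>L = d / (a b)\<close>. Substituting \<open>x = a c / v\<close> and \<open>v = b V\<close>, the sum
  equation becomes the genus one curve \<open>Z\<^sup>2 = (V + q)\<^sup>2 + L\<^sup>2 V\<^sup>2 (V + 1)\<^sup>2\<close> with \<open>q = a c / b\<^sup>2\<close>, which is
  birational to \<open>y\<^sup>2 = x (x\<^sup>2 + (1 + L\<^sup>2) x + 4 L\<^sup>2 q (1 - q))\<close> with the point
  \<open>(-1, L (2 q - 1))\<close>. If \<open>q\<close> and \<open>L\<close> are integral at the prime 2, then twice this point has an
  \<open>x\<close>-coordinate with 2 in the denominator, and each further doubling multiplies \<open>1 / x\<close> by 4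
  times a 2-adic unit, so there are infinitely many points. Integrality can always be arranged: \<open>L\<close> may be replaced by
  \<open>1 / L\<close>, and permuting \<open>a, b, c\<close> gives three values of \<open>q\<close> whose product is 1.
\<close>

section \<open>Arithmetic at the prime 2\<close>

text \<open>This is the localization of the integers at 2. The fraction need not be in lowest terms,
  so closure under ring operations follows by multiplying denominators.\<close>

definition two_integral :: "rat \<Rightarrow> bool" where
  "two_integral r \<longleftrightarrow> (\<exists>m n. odd n \<and> r = of_int m / of_int n)"

definition two_unit :: "rat \<Rightarrow> bool" where
  "two_unit r \<longleftrightarrow> (\<exists>m n. odd m \<and> odd n \<and> r = of_int m / of_int n)"

lemma two_integralI: "odd n \<Longrightarrow> r = of_int m / of_int n \<Longrightarrow> two_integral r"
  unfolding two_integral_def by blast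

lemma two_unitI: "odd m \<Longrightarrow> odd n \<Longrightarrow> r = of_int m / of_int n \<Longrightarrow> two_unit r"
  unfolding two_unit_def by blast

lemma two_integral_of_int [simp]: "two_integral (of_int m)"
  by (rule two_integralI [of 1]) auto

lemma two_integral_numeral [simp]: "two_integral 1" "two_integral (numeral k)"
  using two_integral_of_int [of 1] two_integral_of_int [of "numeral k"] by simp_all

lemma two_integral_add [intro]:
  assumes "two_integral r" "two_integral s"
  shows "two_integral (r + s)"
proof -
  obtain m n where 1: "odd n" "r = of_int m / of_int n"
    using assms(1) unfolding two_integral_def by blast
  obtain m' n' where 2: "odd n'" "s = of_int m' / of_int n'"
    using assms(2) unfolding two_integral_def by blast
  have "n \<noteq> 0" "n' \<noteq> 0" using 1 2 by auto
  then show ?thesis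
    using 1 2 by (intro two_integralI [of "n * n'" _ "m * n' + m' * n"]) (auto simp: field_simps)
qed

lemma two_integral_mult [intro]:
  assumes "two_integral r" "two_integral s"
  shows "two_integral (r * s)"
proof -
  obtain m n where 1: "odd n" "r = of_int m / of_int n"
    using assms(1) unfolding two_integral_def by blast
  obtain m' n' where 2: "odd n'" "s = of_int m' / of_int n'"
    using assms(2) unfolding two_integral_def by blast
  show ?thesis
    using 1 2 by (intro two_integralI [of "n * n'" _ "m * m'"]) auto
qed

lemma two_integral_diff [intro]:
  assumes "two_integral r" "two_integral s"
  shows "two_integral (r - s)"
  using two_integral_add [OF assms(1) two_integral_mult [OF two_integral_of_int [of "-1"] assms(2)]]
  by simp

lemma two_integral_power [intro]: "two_integral r \<Longrightarrow> two_integral (r ^ n)"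
  by (induction n) auto

lemma two_unit_nonzero: "two_unit r \<Longrightarrow> r \<noteq> 0"
  unfolding two_unit_def by auto

lemma two_unit_mult [intro]:
  assumes "two_unit r" "two_unit s"
  shows "two_unit (r * s)"
proof -
  obtain m n where 1: "odd m" "odd n" "r = of_int m / of_int n"
    using assms(1) unfolding two_unit_def by blast
  obtain m' n' where 2: "odd m'" "odd n'" "s = of_int m' / of_int n'"
    using assms(2) unfolding two_unit_def by blast
  show ?thesis
    using 1 2 by (intro two_unitI [of "m * m'" "n * n'"]) auto
qed

lemma two_unit_inverse [intro]: "two_unit r \<Longrightarrow> two_unit (inverse r)"
  unfolding two_unit_def by (metis inverse_divide)

lemma two_unit_divide [intro]: "two_unit r \<Longrightarrow> two_unit s \<Longrightarrow> two_unit (r / s)"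
  by (simp add: divide_inverse two_unit_inverse two_unit_mult)

lemma two_unit_power [intro]: "two_unit r \<Longrightarrow> two_unit (r ^ n)"
  by (induction n) (auto intro: two_unitI [of 1 1])

lemma two_unit_imp_two_integral: "two_unit r \<Longrightarrow> two_integral r"
  unfolding two_unit_def two_integral_def by blast

lemma two_unit_one_plus_double:
  assumes "two_integral r"
  shows "two_unit (1 + 2 * r)"
proof -
  obtain m n where 1: "odd n" "r = of_int m / of_int n"
    using assms unfolding two_integral_def by blast
  moreover have "n \<noteq> 0" using 1 by auto
  ultimately show ?thesis
    by (intro two_unitI [of "n + 2 * m" n]) (auto simp: field_simps)
qed

lemma not_two_unit_double:
  assumes "two_integral r"
  shows "\<not> two_unit (2 * r)"
proof
  assume "two_unit (2 * r)"
  then obtain m n where 1: "odd m" "odd n" "2 * r = of_int m / of_int n"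
    unfolding two_unit_def by blast
  obtain m' n' where 2: "odd n'" "r = of_int m' / of_int n'"
    using assms unfolding two_integral_def by blast
  have "n \<noteq> 0" "n' \<noteq> 0" using 1 2 by auto
  then have "(of_int (2 * m' * n) :: rat) = of_int (m * n')"
    using 1 2 by (simp add: field_simps)
  then have "2 * m' * n = m * n'"
    by (simp only: of_int_eq_iff)
  then show False
    using 1 2 by (metis dvd_triv_left even_mult_iff mult.assoc)
qed

text \<open>In lowest terms the denominator is even, hence the numerator is odd, and inversion swaps
  the two.\<close>

lemma not_two_integral_imp:
  assumes "\<not> two_integral r"
  obtains s where "two_integral s" "inverse r = 2 * s"
proof -
  obtain m n where mn: "r = of_int m / of_int n" "n > 0" "coprime m n"
    by (metis Fract_of_int_quotient quotient_of_div quotient_of_coprime quotient_of_denom_pos prod.collapse)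
  have "even n" using assms mn two_integralI by blast
  then obtain n' where n': "n = 2 * n'" by blast
  have "odd m" using \<open>even n\<close> mn(3) by (auto dest: coprime_common_divisor)
  show ?thesis
  proof
    show "two_integral (of_int n' / of_int m)"
      using \<open>odd m\<close> two_integralI by blast
    show "inverse r = 2 * (of_int n' / of_int m)"
      by (simp add: mn n')
  qed
qed

lemma two_integral_or_inverse: "two_integral r \<or> two_integral (inverse r)"
  using not_two_integral_imp [of r] two_integral_mult [OF two_integral_numeral(2)] by metis

text \<open>Otherwise all three inverses would be doubles of 2-integral numbers, and so would their
  product 1, which is a unit.\<close>

lemma two_integral_of_prod_eq_1:
  assumes "p * q * r = 1"
  shows "two_integral p \<or> two_integral q \<or> two_integral r"
proof (rule ccontr)
  assume "\<not> ?thesis"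
  then obtain p' q' r' where *: "two_integral p'" "inverse p = 2 * p'"
    "two_integral q'" "inverse q = 2 * q'" "two_integral r'" "inverse r = 2 * r'"
    by (metis not_two_integral_imp)
  have "1 = inverse p * inverse q * inverse r"
    using assms by (metis inverse_1 inverse_mult_distrib)
  also have "\<dots> = 2 * (p' * (2 * q') * (2 * r'))"
    by (simp add: *)
  finally have "\<not> two_unit 1"
    using not_two_unit_double * two_integral_mult two_integral_numeral by metis
  then show False
    using two_unitI [of 1 1] by simp
qed

text \<open>Iterating \<open>step\<close> gives elements \<open>4 ^ n * t0 * u n\<close> with units
  \<open>u n\<close>. Their 2-adic valuations strictly increase: a coincidence would make a unit
  twice a 2-integral number.\<close>

lemma infinite_if_closed_under_quadrupling:
  assumes "t0 \<in> T" "0 \<notin> T"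
    and step: "\<And>t. t \<in> T \<Longrightarrow> \<exists>u. two_unit u \<and> 4 * t * u \<in> T"
  shows "infinite T"
proof -
  have "\<exists>u. two_unit u \<and> 4 ^ n * t0 * u \<in> T" for n :: nat
  proof (induction n)
    case 0
    then show ?case
      using assms(1) two_unitI [of 1 1 1] by (intro exI [of _ 1]) auto
  next
    case (Suc n)
    then obtain u where u: "two_unit u" "4 ^ n * t0 * u \<in> T" by blast
    from step [OF u(2)] obtain w where "two_unit w" "4 * (4 ^ n * t0 * u) * w \<in> T" by blast
    with u show ?case
      by (intro exI [of _ "u * w"]) (auto simp: mult_ac)
  qed
  then obtain u where u: "\<And>n. two_unit (u n)" "\<And>n::nat. 4 ^ n * t0 * u n \<in> T"
    by metis
  have "t0 \<noteq> 0" using assms by auto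
  have ne: "4 ^ m * t0 * u m \<noteq> 4 ^ n * t0 * u n" if less: "m < n" for m n :: nat
  proof
    assume eq: "4 ^ m * t0 * u m = 4 ^ n * t0 * u n"
    obtain k where k: "n = m + Suc k" using less_imp_Suc_add [OF less] by auto
    have "u m = 2 * (2 * 4 ^ k * u n)"
      using eq \<open>t0 \<noteq> 0\<close> by (simp add: k power_add)
    moreover have "two_integral (2 * 4 ^ k * u n)"
      by (intro two_integral_mult two_integral_power two_integral_numeral
          two_unit_imp_two_integral u)
    ultimately show False
      using not_two_unit_double u(1) by metis
  qed
  have "inj (\<lambda>n. 4 ^ n * t0 * u n)"
    by (rule injI) (metis ne nat_neq_iff)
  moreover have "range (\<lambda>n. 4 ^ n * t0 * u n) \<subseteq> T"
    using u by auto
  ultimately show ?thesis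
    using finite_subset range_inj_infinite by blast
qed

section \<open>Infinitely many points on the elliptic curve\<close>

text \<open>\<open>x'\<close> is the \<open>x\<close>-coordinate of twice the point
  \<open>(x, y)\<close> by the tangent construction; the witness below is the other coordinate up to
  sign.\<close>

lemma elliptic_doubling:
  fixes A B x y :: "'a :: field_char_0"
  assumes "y\<^sup>2 = x * (x\<^sup>2 + A * x + B)" "y \<noteq> 0"
  defines "x' \<equiv> (x\<^sup>2 - B)\<^sup>2 / (4 * y\<^sup>2)"
  shows "\<exists>y'. y'\<^sup>2 = x' * (x'\<^sup>2 + A * x' + B)"
proof
  define w where "w = y\<^sup>2"
  have w: "w = x * (x\<^sup>2 + A * x + B)" "w \<noteq> 0"
    using assms(1) by (simp add: w_def) (use assms(2) in \<open>simp add: w_def\<close>)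
  let ?C = "x ^ 4 + 2 * A * x ^ 3 + 6 * B * x\<^sup>2 + 2 * A * B * x + B\<^sup>2"
  \<comment> \<open>The right-hand side is \<open>16 * w^2 * (x'^2 + A * x' + B)\<close> with
    denominators cleared.\<close>
  have key: "?C\<^sup>2 = (x\<^sup>2 - B) ^ 4 + 4 * A * w * (x\<^sup>2 - B)\<^sup>2 + 16 * B * w\<^sup>2"
    unfolding w(1) by algebra
  have "((x\<^sup>2 - B) * ?C / (8 * y ^ 3))\<^sup>2 = (x\<^sup>2 - B)\<^sup>2 * ?C\<^sup>2 / (64 * w ^ 3)"
    by (simp add: w_def power_mult_distrib power_divide flip: power_mult)
  also have "\<dots> = x' * (x'\<^sup>2 + A * x' + B)"
    unfolding key x'_def w_def [symmetric] using w(2)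
    by (simp add: field_simps) algebra
  finally show "((x\<^sup>2 - B) * ?C / (8 * y ^ 3))\<^sup>2 = x' * (x'\<^sup>2 + A * x' + B)" .
qed

lemma infinite_elliptic:
  fixes L q :: rat
  assumes L: "two_integral L" "L \<noteq> 0" and q: "two_integral q"
  defines "A \<equiv> 1 + L\<^sup>2" and "B \<equiv> 4 * L\<^sup>2 * q * (1 - q)"
  shows "infinite {x. \<exists>y. y\<^sup>2 = x * (x\<^sup>2 + A * x + B)}"
proof -
  \<comment> \<open>The coordinate \<open>t = 1 / x\<close> is used; requiring
    \<open>t = 2 * s\<close> with \<open>s\<close> 2-integral puts a 2 in the denominator of
    \<open>x\<close>.\<close>
  define T where "T = {t. t \<noteq> 0 \<and> (\<exists>s. two_integral s \<and> t = 2 * s) \<and>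
     (\<exists>y. y\<^sup>2 = inverse t * ((inverse t)\<^sup>2 + A * inverse t + B))}"
  have A: "two_integral A" and B: "two_integral B"
    unfolding A_def B_def using L q
    by (intro two_integral_add two_integral_mult two_integral_diff two_integral_power
        two_integral_numeral; simp)+
  have kappa: "two_unit (2 * q - 1)"
    using two_unit_one_plus_double [of "q - 1"] q by (simp add: algebra_simps two_integral_diff)
  have B1: "two_unit (1 - B)"
  proof -
    have "two_integral (0 - 2 * L\<^sup>2 * q * (1 - q))"
      using L q two_integral_of_int [of 0]
      by (intro two_integral_diff two_integral_mult two_integral_power two_integral_numeral) simp_all
    from two_unit_one_plus_double [OF this] show ?thesis
      by (simp add: B_def algebra_simps)
  qed
  \<comment> \<open>The reciprocal of the \<open>x\<close>-coordinate of twice the point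
    \<open>(-1, L * (2 * q - 1))\<close>.\<close>
  let ?t0 = "4 * (L * (2 * q - 1))\<^sup>2 / (1 - B)\<^sup>2"
  have "infinite T"
  proof (rule infinite_if_closed_under_quadrupling)
    show "?t0 \<in> T"
      unfolding T_def mem_Collect_eq
    proof (intro conjI)
      show "?t0 \<noteq> 0"
        using two_unit_nonzero [OF kappa] two_unit_nonzero [OF B1] L by auto
      have "two_integral (inverse ((1 - B)\<^sup>2))"
        using B1 by (blast intro: two_unit_imp_two_integral)
      then have "two_integral (2 * (L * (2 * q - 1))\<^sup>2 * inverse ((1 - B)\<^sup>2))"
        using L two_unit_imp_two_integral [OF kappa]
        by (intro two_integral_mult two_integral_power two_integral_numeral)
      then show "\<exists>s. two_integral s \<and> ?t0 = 2 * s"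
        by (intro exI conjI, assumption) (simp add: field_simps)
      have "(L * (2 * q - 1))\<^sup>2 = (-1) * ((-1)\<^sup>2 + A * (-1) + B)"
        unfolding A_def B_def by algebra
      from elliptic_doubling [OF this] show "\<exists>y. y\<^sup>2 = inverse ?t0 * ((inverse ?t0)\<^sup>2 + A * inverse ?t0 + B)"
        using L two_unit_nonzero [OF kappa] by simp
    qed
  next
    show "0 \<notin> T" by (simp add: T_def)
  next
    fix t assume "t \<in> T"
    then obtain s y where t: "t \<noteq> 0" "two_integral s" "t = 2 * s"
      and y: "y\<^sup>2 = inverse t * ((inverse t)\<^sup>2 + A * inverse t + B)"
      unfolding T_def by blast
    \<comment> \<open>Doubling sends \<open>t\<close> to \<open>4 * t * ?N / ?D^2\<close>. Since
      \<open>t\<close> is even at 2 and \<open>A\<close>, \<open>B\<close> are 2-integral,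
      \<open>?N\<close> and \<open>?D\<close> are units.\<close>
    let ?N = "1 + A * t + B * t\<^sup>2" and ?D = "1 - B * t\<^sup>2"
    have "two_unit (1 + 2 * (A * s + 2 * B * s\<^sup>2))" "two_unit (1 + 2 * (0 - 2 * B * s\<^sup>2))"
      using A B t two_integral_of_int [of 0]
      by (intro two_unit_one_plus_double two_integral_add two_integral_diff two_integral_mult
          two_integral_power two_integral_numeral; simp)+
    then have N: "two_unit ?N" and D: "two_unit ?D"
      by (simp_all add: t(3) algebra_simps)
    have y': "y\<^sup>2 = ?N / t ^ 3"
      unfolding y using t(1) by (simp add: field_simps power2_eq_square power3_eq_cube)
    have y0: "y \<noteq> 0"
      using y' two_unit_nonzero [OF N] t(1) by auto
    let ?t' = "4 * t * (?N / ?D\<^sup>2)"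
    have u: "two_unit (?N / ?D\<^sup>2)" using N D by auto
    have t': "inverse ?t' = ((inverse t)\<^sup>2 - B)\<^sup>2 / (4 * y\<^sup>2)"
    proof -
      have "(inverse t)\<^sup>2 - B = ?D / t\<^sup>2" using t(1) by (simp add: field_simps)
      moreover have "inverse (4 * t * (n / m\<^sup>2)) = (m / t\<^sup>2)\<^sup>2 / (4 * (n / t ^ 3))"
        if "n \<noteq> 0" "m \<noteq> 0" for n m :: rat
        using that t(1) by (simp add: field_simps power2_eq_square power3_eq_cube)
      ultimately show ?thesis
        unfolding y' using two_unit_nonzero [OF N] two_unit_nonzero [OF D] by simp
    qed
    have "?t' \<in> T"
      unfolding T_def mem_Collect_eq
    proof (intro conjI)
      show "?t' \<noteq> 0" using t(1) two_unit_nonzero [OF u] by simp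
      show "\<exists>s. two_integral s \<and> ?t' = 2 * s"
      proof (intro exI conjI)
        show "two_integral (2 * t * (?N / ?D\<^sup>2))"
          unfolding t(3) by (intro two_integral_mult two_integral_numeral t(2)
              two_unit_imp_two_integral u [unfolded t(3)])
      qed simp
      show "\<exists>y. y\<^sup>2 = inverse ?t' * ((inverse ?t')\<^sup>2 + A * inverse ?t' + B)"
        unfolding t' by (rule elliptic_doubling [OF y y0])
    qed
    with u show "\<exists>u. two_unit u \<and> 4 * t * u \<in> T" by blast
  qed
  then have "infinite (inverse ` T)"
    by (simp add: finite_image_iff inj_on_def)
  moreover have "inverse ` T \<subseteq> {x. \<exists>y. y\<^sup>2 = x * (x\<^sup>2 + A * x + B)}"
    unfolding T_def by auto
  ultimately show ?thesis
    using finite_subset by blast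
qed

section \<open>The genus one quartic\<close>

definition quartic_points :: "rat \<Rightarrow> rat \<Rightarrow> (rat \<times> rat) set" where
  "quartic_points L q = {(V, Z). Z\<^sup>2 = (V + q)\<^sup>2 + L\<^sup>2 * (V * (V + 1))\<^sup>2}"

lemma infinite_quartic_points_two_integral:
  assumes L: "two_integral L" "L \<noteq> 0" and q: "two_integral q"
  shows "infinite (quartic_points L q)"
proof
  assume fin: "finite (quartic_points L q)"
  \<comment> \<open>Writing \<open>Z = L V (V + 1) + w\<close> leaves a quadratic equation for \<open>V\<close>; with \<open>x = - 2 L w\<close> its
    discriminant is, up to squares, the right-hand side of the Weierstrass equation.\<close>
  let ?E = "{x. \<exists>y. y\<^sup>2 = x * (x\<^sup>2 + (1 + L\<^sup>2) * x + 4 * L\<^sup>2 * q * (1 - q))}"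
  have "?E - {-1} \<subseteq> (\<lambda>(V, Z). - 2 * L * (Z - L * (V * (V + 1)))) ` quartic_points L q"
  proof
    fix x assume "x \<in> ?E - {-1}"
    then obtain y where y: "y\<^sup>2 = x * (x\<^sup>2 + (1 + L\<^sup>2) * x + 4 * L\<^sup>2 * q * (1 - q))"
      and x: "1 + x \<noteq> 0" by (auto simp: add_eq_0_iff)
    \<comment> \<open>A root of that quadratic, by completing the square. Its leading coefficient is
      \<open>-(1 + x)\<close>, hence the exclusion of \<open>x = -1\<close>.\<close>
    define V where "V = (y - L * (2 * q + x)) / (2 * L * (1 + x))"
    define w where "w = - x / (2 * L)"
    have "2 * L * (1 + x) * V + L * (2 * q + x) = y"
      using x L(2) by (simp add: V_def)
    moreover have w: "x = - 2 * L * w"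
      using L(2) by (simp add: w_def)
    ultimately have *: "(2 * L * (1 + x) * V + L * (2 * q + x))\<^sup>2
        = x * (x\<^sup>2 + (1 + L\<^sup>2) * x + 4 * L\<^sup>2 * q * (1 - q))"
      using y by simp
    have "4 * L\<^sup>2 * (1 + x) * ((L * (V * (V + 1)) + w)\<^sup>2 - (V + q)\<^sup>2 - L\<^sup>2 * (V * (V + 1))\<^sup>2) = 0"
      using * unfolding w by algebra
    then have "(V, L * (V * (V + 1)) + w) \<in> quartic_points L q"
      using x L(2) by (simp add: quartic_points_def)
    then show "x \<in> (\<lambda>(V, Z). - 2 * L * (Z - L * (V * (V + 1)))) ` quartic_points L q"
      by (rule rev_image_eqI) (simp add: w)
  qed
  then have "finite ?E"
    using fin by (meson finite_Diff_insert finite_imageI finite_subset finite.emptyI infinite_remove)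
  then show False
    using infinite_elliptic [OF assms] by simp
qed

text \<open>The involution \<open>V \<mapsto> q / V\<close> exchanges the two squares up to the factor \<open>L\<^sup>2\<close>.\<close>
lemma infinite_quartic_points:
  assumes L: "L \<noteq> 0" and q: "two_integral q" "q \<noteq> 0"
  shows "infinite (quartic_points L q)"
proof (cases "two_integral L")
  case True
  then show ?thesis using assms infinite_quartic_points_two_integral by blast
next
  case False
  then have inf: "infinite (quartic_points (inverse L) q)"
    using infinite_quartic_points_two_integral two_integral_or_inverse assms
    by (metis nonzero_imp_inverse_nonzero)
  \<comment> \<open>Only the points with \<open>V = 0\<close> are removed, where the involution is
    undefined.\<close>
  let ?S = "quartic_points (inverse L) q - {(0, q), (0, - q)}"
  let ?F = "\<lambda>(V, Z). (q / V, L * q * Z / V\<^sup>2)"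
  have V0: "V \<noteq> 0" if "(V, Z) \<in> ?S" for V Z
    using that by (auto simp: quartic_points_def power2_eq_iff)
  have "inj_on ?F ?S"
  proof (rule inj_on_inverseI)
    fix p assume "p \<in> ?S"
    then have "fst p \<noteq> 0" using V0 by (metis prod.collapse)
    then show "(\<lambda>(W, Z). (q / W, Z * (q / W)\<^sup>2 / (L * q))) (?F p) = p"
      using q(2) L by (simp add: case_prod_beta)
  qed
  moreover have "infinite ?S" using inf by simp
  ultimately have "infinite (?F ` ?S)" using finite_image_iff by blast
  moreover have "?F ` ?S \<subseteq> quartic_points L q"
  proof (rule image_subsetI, unfold split_paired_all)
    fix V Z assume VZ: "(V, Z) \<in> ?S"
    then have V: "V \<noteq> 0" by (rule V0)
    have Z: "Z\<^sup>2 = (V + q)\<^sup>2 + (inverse L)\<^sup>2 * (V * (V + 1))\<^sup>2"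
      using VZ by (simp add: quartic_points_def)
    have "(L * q * Z / V\<^sup>2)\<^sup>2 = L\<^sup>2 * q\<^sup>2 * Z\<^sup>2 / V ^ 4"
      by (simp add: power_mult_distrib power_divide flip: power_mult)
    also have "\<dots> = (q / V + q)\<^sup>2 + L\<^sup>2 * (q / V * (q / V + 1))\<^sup>2"
      unfolding Z using V L by (simp add: field_simps) algebra
    finally show "?F (V, Z) \<in> quartic_points L q"
      by (simp add: quartic_points_def)
  qed
  ultimately show ?thesis using finite_subset by blast
qed

text \<open>At most two values of \<open>Z\<close> lie over each \<open>V\<close>, so discarding
  finitely many \<open>V\<close> costs only finitely many points.\<close>

lemma finite_quartic_points_above:
  assumes "finite S"
  shows "finite {p \<in> quartic_points L q. fst p \<in> S}"
proof -
  have "finite {Z :: rat. Z\<^sup>2 = r}" for r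
    using poly_roots_finite [of "[:- r, 0, 1:]"] by (simp add: power2_eq_square algebra_simps)
  then have "finite (SIGMA V:S. {Z. Z\<^sup>2 = (V + q)\<^sup>2 + L\<^sup>2 * (V * (V + 1))\<^sup>2})"
    using assms by auto
  then show ?thesis
    by (rule rev_finite_subset) (auto simp: quartic_points_def)
qed


section \<open>Degenerate case: the sum equation\<close>

definition cubic_over_linear :: "rat \<Rightarrow> rat \<Rightarrow> rat \<Rightarrow> rat \<Rightarrow> rat" where
  "cubic_over_linear a b c x = (x + a) * (x + b) * (x + c) / x"

lemma infinite_same_function_solutions:
  fixes a b c L :: rat
  assumes "a \<noteq> 0" "b \<noteq> 0" "c \<noteq> 0" "L \<noteq> 0" and q: "two_integral (a * c / b\<^sup>2)"
  defines "F \<equiv> cubic_over_linear a b c"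
  shows "infinite {s \<in> sum_solutions F (\<lambda>v. L * F v). nontrivial F (\<lambda>v. L * F v) s}"
proof -
  define q where "q = a * c / b\<^sup>2"
  have q0: "q \<noteq> 0" using assms by (simp add: q_def)
  have ac: "a * c = b\<^sup>2 * q" using assms by (simp add: q_def)
  \<comment> \<open>The common factor in \<open>F (b * q / V) = H V * (V + q)\<close> and
    \<open>F (b * V) = H V * (V * (V + 1))\<close>; here
    \<open>b * q / V = a * c / (b * V)\<close>.\<close>
  define H where "H V = (b * V + a) * (b * V + c) / V\<^sup>2" for V
  define \<Phi> where "\<Phi> = (\<lambda>(V, Z). (b * q / V, b * V, H V * Z))"
  \<comment> \<open>The listed values are the pole and the zeros of the two function values. The
    quadratics express \<open>V + q = L * V * (V + 1)\<close> and
    \<open>V + q = - L * V * (V + 1)\<close>, where the two squares coincide.\<close>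
  define bad where "bad = {0, -1, - a / b, - c / b, - q} \<union>
    {V. poly [:- q, L - 1, L:] V = 0} \<union> {V. poly [:q, L + 1, L:] V = 0}"
  define P where "P = quartic_points L q - {p \<in> quartic_points L q. fst p \<in> bad}"
  have "finite bad"
    unfolding bad_def using assms(4) by (intro finite_UnI poly_roots_finite) auto
  then have "infinite P"
    unfolding P_def using infinite_quartic_points [of L q] finite_quartic_points_above q q0 assms(4)
    by (simp add: q_def)
  moreover have H0: "H V \<noteq> 0" "V \<noteq> 0" if "(V, Z) \<in> P" for V Z
  proof -
    have V: "V \<notin> bad" using that by (auto simp: P_def)
    then show "V \<noteq> 0" by (auto simp: bad_def)
    have "b * V + a \<noteq> 0" "b * V + c \<noteq> 0"
      using V assms(2) by (auto simp: bad_def field_simps eq_neg_iff_add_eq_0)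
    with \<open>V \<noteq> 0\<close> show "H V \<noteq> 0" by (simp add: H_def)
  qed
  then have "inj_on \<Phi> P"
    using assms(2) by (intro inj_onI) (auto simp: \<Phi>_def)
  ultimately have "infinite (\<Phi> ` P)"
    using finite_image_iff by blast
  moreover have "\<Phi> ` P \<subseteq> {s \<in> sum_solutions F (\<lambda>v. L * F v). nontrivial F (\<lambda>v. L * F v) s}"
  proof (rule image_subsetI, unfold split_paired_all)
    fix V Z assume VZ: "(V, Z) \<in> P"
    then have Z: "Z\<^sup>2 = (V + q)\<^sup>2 + L\<^sup>2 * (V * (V + 1))\<^sup>2"
      and V: "V \<notin> bad"
      by (auto simp: P_def quartic_points_def)
    note H0 = H0 [OF VZ]
    have Fx: "F (b * q / V) = H V * (V + q)"
    proof -
      have "F (b * q / V) = (b * q / V + a) * (b * q / V + c) * (b * q / V + b) / (b * q / V)"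
        by (simp add: F_def cubic_over_linear_def mult_ac)
      also have "(b * q / V + a) * (b * q / V + c) = q * (b * V + a) * (b * V + c) / V\<^sup>2"
        using H0(2) ac by (simp add: field_simps) algebra
      also have "q * (b * V + a) * (b * V + c) / V\<^sup>2 = q * H V"
        by (simp add: H_def)
      also have "b * q / V + b = b * (V + q) / V"
        using H0(2) by (simp add: field_simps)
      finally show ?thesis
        using H0(2) q0 assms(2) by simp
    qed
    have Fv: "F (b * V) = H V * (V * (V + 1))"
      using H0(2) assms(2) by (simp add: F_def cubic_over_linear_def H_def field_simps power2_eq_square)
    have ne: "V + q \<noteq> 0" "V + 1 \<noteq> 0"
      using V by (auto simp: bad_def add_eq_0_iff2)
    have "V + q \<noteq> L * (V * (V + 1))" "V + q \<noteq> - (L * (V * (V + 1)))"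
      using V by (auto simp: bad_def algebra_simps)
    then have "(V + q)\<^sup>2 \<noteq> (L * (V * (V + 1)))\<^sup>2"
      by (simp add: power2_eq_iff)
    moreover have "(F (b * q / V))\<^sup>2 = (H V)\<^sup>2 * (V + q)\<^sup>2"
      "(L * F (b * V))\<^sup>2 = (H V)\<^sup>2 * (L * (V * (V + 1)))\<^sup>2"
      by (simp_all add: Fx Fv power_mult_distrib)
    moreover have "(H V)\<^sup>2 \<noteq> 0"
      using H0 by simp
    ultimately have "(F (b * q / V))\<^sup>2 \<noteq> (L * F (b * V))\<^sup>2"
      by simp
    moreover have "F (b * q / V) * (L * F (b * V)) \<noteq> 0"
      using H0 ne assms(2,4) by (simp add: Fx Fv)
    moreover have "(H V * Z)\<^sup>2 = (F (b * q / V))\<^sup>2 + (L * F (b * V))\<^sup>2"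
      unfolding Fx Fv using Z by algebra
    moreover have "b * q / V \<noteq> 0" "b * V \<noteq> 0"
      using H0 q0 assms(2) by simp_all
    ultimately show "\<Phi> (V, Z) \<in> {s \<in> sum_solutions F (\<lambda>v. L * F v). nontrivial F (\<lambda>v. L * F v) s}"
      unfolding \<Phi>_def sum_solutions_def nontrivial_def mem_Collect_eq prod.case by blast
  qed
  ultimately show ?thesis using finite_subset by blast
qed

text \<open>By \<open>c * d = b * e\<close>, the numbers \<open>d\<close>, \<open>e\<close>,
  \<open>c d / a\<close> are \<open>c d\<close> times the reciprocals of \<open>c\<close>,
  \<open>b\<close>, \<open>a\<close>. Hence \<open>y = c d / v\<close> turns \<open>g\<close> into a
  multiple of \<open>f\<close>.\<close>

lemma infinite_degenerate_solutions:
  fixes a b c d e :: int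
  assumes nz: "a \<noteq> 0" "b \<noteq> 0" "c \<noteq> 0" "d \<noteq> 0" and deg: "c * d = b * e"
  defines "f \<equiv> laurent_f a b c" and "g \<equiv> laurent_g a c d e"
  shows "infinite {s \<in> sum_solutions f g. nontrivial f g s}"
proof -
  define A B C L :: rat where defs: "A = of_int a" "B = of_int b" "C = of_int c"
    "L = of_int d / (of_int a * of_int b)"
  define D :: rat where "D = of_int d"
  have nz': "A \<noteq> 0" "B \<noteq> 0" "C \<noteq> 0" "D \<noteq> 0" "L \<noteq> 0"
    using nz by (simp_all add: defs D_def)
  have e: "of_int e = C * D / B"
    using deg nz unfolding defs D_def
    by (metis nonzero_mult_div_cancel_left of_int_eq_0_iff of_int_mult)
  have f: "f = cubic_over_linear A B C"
    by (simp add: f_def laurent_f_def cubic_over_linear_def fun_eq_iff defs)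
  have g: "g (C * D / v) = L * f v" if "v \<noteq> 0" for v
    using that nz' unfolding g_def laurent_g_def e f cubic_over_linear_def
    by (simp add: defs(4) flip: defs(1-3) D_def) (simp add: field_simps power2_eq_square)
  have inf: "infinite {s \<in> sum_solutions f (\<lambda>v. L * f v). nontrivial f (\<lambda>v. L * f v) s}"
    (is "infinite ?S")
  proof -
    \<comment> \<open>\<open>f\<close> is symmetric in \<open>A\<close>, \<open>B\<close>,
      \<open>C\<close> and \<open>L\<close> stays fixed, so any one of these ratios may serve as
      \<open>q\<close>.\<close>
    have "(A * C / B\<^sup>2) * (A * B / C\<^sup>2) * (B * C / A\<^sup>2) = 1"
      using nz' by (simp add: power2_eq_square)
    then consider "two_integral (A * C / B\<^sup>2)" | "two_integral (A * B / C\<^sup>2)" | "two_integral (B * C / A\<^sup>2)"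
      using two_integral_of_prod_eq_1 by blast
    then show ?thesis
    proof cases
      case 1
      then show ?thesis
        unfolding f using nz' by (intro infinite_same_function_solutions) auto
    next
      case 2
      have "f = cubic_over_linear A C B" by (simp add: f cubic_over_linear_def fun_eq_iff mult_ac)
      with 2 show ?thesis
        using nz' infinite_same_function_solutions [of A C B L] by simp
    next
      case 3
      have "f = cubic_over_linear B A C" by (simp add: f cubic_over_linear_def fun_eq_iff mult_ac)
      with 3 show ?thesis
        using nz' infinite_same_function_solutions [of B A C L] by simp
    qed
  qed
  let ?F = "\<lambda>(x, v, z). (x, C * D / v, z)"
  have "inj_on ?F ?S"
    using nz' by (intro inj_onI) (auto simp: sum_solutions_def)
  with inf have "infinite (?F ` ?S)"
    using finite_image_iff by blast
  moreover have "?F ` ?S \<subseteq> {s \<in> sum_solutions f g. nontrivial f g s}"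
    using nz' by (auto simp: sum_solutions_def nontrivial_def g)
  ultimately show ?thesis using finite_subset by blast
qed

section \<open>Nondegenerate case: the difference equation as a conic\<close>

text \<open>Apart from \<open>m = 0, 1, -1\<close>, every condition that excludes a conic parameter
  \<open>m\<close> has this shape.\<close>

lemma finite_palindromic_quadratic_roots:
  fixes r s :: "'a :: field_char_0"
  assumes "r \<noteq> 0 \<or> s \<noteq> 0"
  shows "finite {m. r * (m\<^sup>2 + 1) + 2 * s * m = 0}"
proof -
  have "finite {m. poly [:r, 2 * s, r:] m = 0}"
    using assms by (intro poly_roots_finite) auto
  then show ?thesis
    by (simp add: algebra_simps power2_eq_square)
qed

lemma infinite_nondegenerate_solutions:
  fixes a b c d e :: int
  assumes nz: "a \<noteq> 0" "b \<noteq> 0" "c \<noteq> 0" "d \<noteq> 0" "e \<noteq> 0" and nondeg: "c * d \<noteq> b * e"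
  defines "f \<equiv> laurent_f a b c" and "g \<equiv> laurent_g a c d e"
  shows "infinite {s \<in> diff_solutions f g. nontrivial f g s}"
proof -
  define A B C E k :: rat where defs: "A = of_int a" "B = of_int b" "C = of_int c" "E = of_int e"
    "k = of_int d / of_int a"
  have nz': "A \<noteq> 0" "B \<noteq> 0" "C \<noteq> 0" "E \<noteq> 0" "k \<noteq> 0"
    using nz by (simp_all add: defs)
  have "(of_int (c * d) :: rat) \<noteq> of_int (b * e)"
    using nondeg by (simp only: of_int_eq_iff not_False_eq_True)
  then have nd: "A * C * k \<noteq> B * E"
    using nz by (simp add: defs)
  \<comment> \<open>The ratio of the linear forms is set to \<open>(m^2 + 1) / (2 * m)\<close>,
    hypotenuse over leg of a Pythagorean triple. This equation is linear in \<open>w\<close>, with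
    solution \<open>N m / M m\<close>.\<close>
  define N M where "N m = E * (m\<^sup>2 + 1) + 2 * (- A * C) * m"
    and "M m = (- k) * (m\<^sup>2 + 1) + 2 * B * m" for m
  define w where "w m = N m / M m" for m
  define h where "h t = (t + A) * (t + C) / t" for t
  define T where "T m = (E + k * w m) / w m" for m
  define G where "G m = h (w m) * T m" for m
  \<comment> \<open>The last two quadratics are the numerators \<open>N m + A * M m\<close> and
    \<open>N m + C * M m\<close> of \<open>w m + A\<close> and \<open>w m + C\<close>; at
    \<open>m = 1\<close> and \<open>m = -1\<close> the value of \<open>z\<close> would be 0.\<close>
  define bad where "bad = {0, 1, -1} \<union> {m. N m = 0} \<union> {m. M m = 0} \<union>
     {m. (E - A * k) * (m\<^sup>2 + 1) + 2 * (A * (B - C)) * m = 0} \<union>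
     {m. (E - C * k) * (m\<^sup>2 + 1) + 2 * (C * (B - A)) * m = 0}"
  \<comment> \<open>\<open>E = A * k\<close> with \<open>B = C\<close>, or \<open>E = C * k\<close>
    with \<open>B = A\<close>, would give \<open>A * C * k = B * E\<close>. So \<open>nd\<close>
    keeps the last two quadratics from vanishing identically.\<close>
  have "finite bad"
    unfolding bad_def N_def M_def
    by (intro finite_UnI finite_palindromic_quadratic_roots) (use nz' nd in auto)
  then have inf: "infinite (- bad)"
    by (simp add: infinite_UNIV_char_0 finite_compl Compl_eq_Diff_UNIV)
  define \<Phi> where "\<Phi> m = (A * C / w m, k * w m, G m * (m\<^sup>2 - 1) / (2 * m))" for m
  have main: "w m \<noteq> 0 \<and> f (A * C / w m) = G m * (m\<^sup>2 + 1) / (2 * m) \<and> g (k * w m) = G m \<and> G m \<noteq> 0"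
    if m: "m \<notin> bad" for m
  proof -
    have m0: "m \<noteq> 0" "N m \<noteq> 0" "M m \<noteq> 0" using m by (auto simp: bad_def)
    then have w0: "w m \<noteq> 0" by (simp add: w_def)
    have "w m * M m = N m" using m0 by (simp add: w_def)
    then have ratio: "(A * C + B * w m) * (2 * m) = (E + k * w m) * (m\<^sup>2 + 1)"
      unfolding N_def M_def by algebra
    have fx: "f (A * C / w m) = h (w m) * ((A * C + B * w m) / w m)"
      using w0 nz' unfolding f_def laurent_f_def h_def defs(1-3) [symmetric]
      by (simp add: field_simps)
    have gy: "g (k * w m) = G m"
    proof -
      have "of_int d = A * k" using nz by (simp add: defs)
      then show ?thesis
        using w0 nz' unfolding g_def laurent_g_def G_def T_def h_def defs(1-4) [symmetric]
        by (simp add: field_simps power2_eq_square)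
    qed
    have "w m + A \<noteq> 0" "w m + C \<noteq> 0"
      using m m0 by (auto simp: bad_def w_def N_def M_def field_simps)
    then have "h (w m) \<noteq> 0" using w0 by (simp add: h_def)
    \<comment> \<open>A common zero of the two linear forms would make them proportional, against
      \<open>nd\<close>.\<close>
    moreover have "E + k * w m \<noteq> 0"
    proof
      assume Y: "E + k * w m = 0"
      then have "A * C + B * w m = 0" using ratio m0 by simp
      with Y have "A * C * k = B * E" by algebra
      with nd show False by simp
    qed
    ultimately have "G m \<noteq> 0" using w0 by (simp add: G_def T_def)
    moreover have "f (A * C / w m) = G m * (m\<^sup>2 + 1) / (2 * m)"
    proof -
      have "A * C + B * w m = (E + k * w m) * (m\<^sup>2 + 1) / (2 * m)"
        using ratio m0 by (simp add: field_simps)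
      then show ?thesis by (simp add: fx G_def T_def mult_ac)
    qed
    ultimately show ?thesis using w0 gy by blast
  qed
  \<comment> \<open>The parameter is recovered from \<open>(m\<^sup>2 - 1) / (2 m) + (m\<^sup>2 + 1) / (2 m) = m\<close>.\<close>
  have "inj_on \<Phi> (- bad)"
  proof (rule inj_on_inverseI)
    fix m assume "m \<in> - bad"
    then have "m \<notin> bad" and "m \<noteq> 0" by (auto simp: bad_def)
    with main show "(\<lambda>(x, y, z). (z + f x) / g y) (\<Phi> m) = m"
      by (simp add: \<Phi>_def field_simps power2_eq_square)
  qed
  with inf have "infinite (\<Phi> ` (- bad))"
    using finite_image_iff by blast
  moreover have "\<Phi> ` (- bad) \<subseteq> {s \<in> diff_solutions f g. nontrivial f g s}"
  proof (rule image_subsetI)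
    fix m assume "m \<in> - bad"
    then have "m \<notin> bad" by simp
    note * = main [OF this]
    have m: "m \<noteq> 0" "m\<^sup>2 - 1 \<noteq> 0" using \<open>m \<notin> bad\<close> by (auto simp: bad_def power2_eq_1_iff)
    have m2: "m\<^sup>2 + 1 \<noteq> 0" using zero_le_power2 [of m] by linarith
    have diff: "(G m * (m\<^sup>2 - 1) / (2 * m))\<^sup>2 = (G m * (m\<^sup>2 + 1) / (2 * m))\<^sup>2 - (G m)\<^sup>2"
      using m by (simp add: field_simps) algebra
    moreover have "(G m * (m\<^sup>2 - 1) / (2 * m))\<^sup>2 \<noteq> 0"
      using m * by simp
    ultimately show "\<Phi> m \<in> {s \<in> diff_solutions f g. nontrivial f g s}"
      using * m m2 nz' unfolding \<Phi>_def diff_solutions_def nontrivial_def by auto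
  qed
  ultimately show ?thesis using finite_subset by blast
qed

theorem theorem1p4:
  fixes a b c d e :: int
  assumes "a \<noteq> 0" and "b \<noteq> 0" and "c \<noteq> 0" and "d \<noteq> 0" and "e \<noteq> 0"
  shows "infinite {s \<in> sum_solutions (laurent_f a b c) (laurent_g a c d e).
             nontrivial (laurent_f a b c) (laurent_g a c d e) s}
       \<or> infinite {s \<in> diff_solutions (laurent_f a b c) (laurent_g a c d e).
             nontrivial (laurent_f a b c) (laurent_g a c d e) s}"
  using infinite_degenerate_solutions [OF assms(1-4)] infinite_nondegenerate_solutions [OF assms]
  by blast

end
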